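(* Let $E$ be a Banach lattice with order continuous norm and a weak unit, and let $T$ be a positive, power-bounded, irreducible and mean ergodic operator on $E$ whose mean ergodic projection $P$ is non-zero. Let $A_n := \frac1n\sum_{k=0}^{n-1} T^k$, $n \in \mathbb{N}$. Then, for each $x \in E$, the sequence $(A_n x)_{n\in\mathbb{N}}$ is uo-convergent to $Px$ in $E$.
   Context: The norm of a Banach lattice is order continuous if $x_\alpha \downarrow 0$ implies $\|x_\alpha\| \to 0$ for each decreasing net. An element $u \in E_+$ is a weak unit if $x \wedge u = 0$ implies $x = 0$ for each $x \in E_+$. $T$ is power-bounded if $\sup_n \|T^n\| < \infty$; mean ergodic if the Cesàro means $A_n$ converge strongly, the limit $P$ being the mean ergodic projection; irreducible if $\{0\}$ and $E$ are the only closed $T$-invariant (lattice) ideals of $E$. A sequence $(x_n)$ in $E$ is order convergent to $x$ if there is a sequence $y_n \downarrow 0$ in $E$ with $|x_n - x| \le y_n$ for all $n$; it is uo-convergent to $x$ if $|x_n - x| \wedge u$ is order convergent to $0$ for each $u \in E_+$. *)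

theory Defs
  imports "HOL-Analysis.Analysis" "HOL-Library.Lattice_Algebras" "HOL-Library.Lub_Glb"
begin

(* Real Banach lattices; abs_lattice from lattice_ab_group_add_abs gives |x| = sup x (- x). *)
class banach_lattice = banach + ordered_real_vector + lattice_ab_group_add_abs +
  assumes norm_mono_abs: "\<bar>x\<bar> \<le> \<bar>y\<bar> \<Longrightarrow> norm x \<le> norm y"

definition directed_set :: "'i set \<Rightarrow> 'i rel \<Rightarrow> bool" where
  "directed_set I r \<longleftrightarrow>
     I \<noteq> {} \<and> preorder_on I r \<and> (\<forall>i\<in>I. \<forall>j\<in>I. \<exists>k\<in>I. (i, k) \<in> r \<and> (j, k) \<in> r)"

(* The filter of tails: convergence of a net indexed by (I, r) is convergence along it. *)
definition tails :: "'i set \<Rightarrow> 'i rel \<Rightarrow> 'i filter" where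
  "tails I r = (INF i\<in>I. principal {j \<in> I. (i, j) \<in> r})"

definition net_decreases_to :: "'i set \<Rightarrow> 'i rel \<Rightarrow> ('i \<Rightarrow> 'a::order) \<Rightarrow> 'a \<Rightarrow> bool" where
  "net_decreases_to I r x l \<longleftrightarrow>
     (\<forall>i\<in>I. \<forall>j\<in>I. (i, j) \<in> r \<longrightarrow> x j \<le> x i) \<and> isGlb UNIV (x ` I) l"

(* A definition cannot quantify over the type of the index set, so the nets here are indexed by
   directed sets of elements of the space itself. Nothing is lost: order_continuous_norm_net
   below derives the property for nets over an arbitrary index type. *)
definition order_continuous_norm :: "'a::banach_lattice itself \<Rightarrow> bool" where
  "order_continuous_norm _ \<longleftrightarrow>
     (\<forall>(I :: 'a set) r (x :: 'a \<Rightarrow> 'a). directed_set I r \<and> net_decreases_to I r x 0 \<longrightarrow>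
        ((\<lambda>i. norm (x i)) \<longlongrightarrow> 0) (tails I r))"

definition weak_unit :: "'a::banach_lattice \<Rightarrow> bool" where
  "weak_unit u \<longleftrightarrow> 0 \<le> u \<and> (\<forall>x\<ge>0. inf x u = 0 \<longrightarrow> x = 0)"

definition positive_operator :: "('a::banach_lattice \<Rightarrow> 'a) \<Rightarrow> bool" where
  "positive_operator T \<longleftrightarrow> bounded_linear T \<and> (\<forall>x\<ge>0. 0 \<le> T x)"

definition power_bounded :: "('a::banach_lattice \<Rightarrow> 'a) \<Rightarrow> bool" where
  "power_bounded T \<longleftrightarrow> bdd_above (range (\<lambda>n. onorm (T ^^ n)))"

definition lattice_ideal :: "'a::banach_lattice set \<Rightarrow> bool" where
  "lattice_ideal J \<longleftrightarrow> subspace J \<and> (\<forall>x\<in>J. \<forall>y. \<bar>y\<bar> \<le> \<bar>x\<bar> \<longrightarrow> y \<in> J)"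

definition irreducible_operator :: "('a::banach_lattice \<Rightarrow> 'a) \<Rightarrow> bool" where
  "irreducible_operator T \<longleftrightarrow>
     (\<forall>J. lattice_ideal J \<and> closed J \<and> T ` J \<subseteq> J \<longrightarrow> J = {0} \<or> J = UNIV)"

(* Meaningful for n > 0 only; the value at n = 0 is 0. *)
definition cesaro_mean :: "('a::banach_lattice \<Rightarrow> 'a) \<Rightarrow> nat \<Rightarrow> 'a \<Rightarrow> 'a" where
  "cesaro_mean T n x = (1 / real n) *\<^sub>R (\<Sum>k<n. (T ^^ k) x)"

definition mean_ergodic :: "('a::banach_lattice \<Rightarrow> 'a) \<Rightarrow> bool" where
  "mean_ergodic T \<longleftrightarrow> (\<forall>x. convergent (\<lambda>n. cesaro_mean T n x))"

definition mean_ergodic_projection :: "('a::banach_lattice \<Rightarrow> 'a) \<Rightarrow> 'a \<Rightarrow> 'a" where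
  "mean_ergodic_projection T x = lim (\<lambda>n. cesaro_mean T n x)"

definition order_convergent_to :: "(nat \<Rightarrow> 'a::banach_lattice) \<Rightarrow> 'a \<Rightarrow> bool" where
  "order_convergent_to x l \<longleftrightarrow>
     (\<exists>y. decseq y \<and> isGlb UNIV (range y) 0 \<and> (\<forall>n. \<bar>x n - l\<bar> \<le> y n))"

definition uo_convergent_to :: "(nat \<Rightarrow> 'a::banach_lattice) \<Rightarrow> 'a \<Rightarrow> bool" where
  "uo_convergent_to x l \<longleftrightarrow> (\<forall>u\<ge>0. order_convergent_to (\<lambda>n. inf \<bar>x n - l\<bar> u) 0)"

lemma order_continuous_norm_net:
  fixes x :: "'i \<Rightarrow> 'a::banach_lattice"
  assumes oc: "order_continuous_norm TYPE('a)"
    and dir: "directed_set I r" and dec: "net_decreases_to I r x 0"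
  shows "((\<lambda>i. norm (x i)) \<longlongrightarrow> 0) (tails I r)"
proof -
  have ev: "eventually Q (tails K s) \<longleftrightarrow> (\<exists>i\<in>K. \<forall>j\<in>K. (i, j) \<in> s \<longrightarrow> Q j)"
    if d: "directed_set K s" for Q and K :: "'k set" and s
    unfolding tails_def
  proof (subst eventually_INF_base)
    show "K \<noteq> {}" using d by (simp add: directed_set_def)
    show "\<exists>k\<in>K. principal {j \<in> K. (k, j) \<in> s} \<le>
        inf (principal {j \<in> K. (a, j) \<in> s}) (principal {j \<in> K. (b, j) \<in> s})"
      if "a \<in> K" "b \<in> K" for a b
    proof -
      from d that obtain k where k: "k \<in> K" "(a, k) \<in> s" "(b, k) \<in> s"
        unfolding directed_set_def by blast
      have "trans s" using d by (simp add: directed_set_def preorder_on_def)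
      then have "{j \<in> K. (k, j) \<in> s} \<subseteq> {j \<in> K. (a, j) \<in> s} \<inter> {j \<in> K. (b, j) \<in> s}"
        using k by (auto dest: transD)
      then show ?thesis using k(1) by auto
    qed
  qed (auto simp: eventually_principal)
  let ?D = "x ` I" and ?s = "{(a, b). a \<in> x ` I \<and> b \<in> x ` I \<and> b \<le> a}"
  have anti: "x j \<le> x i" if "i \<in> I" "j \<in> I" "(i, j) \<in> r" for i j
    using dec that by (auto simp: net_decreases_to_def)
  have ddir: "directed_set ?D ?s"
    unfolding directed_set_def
  proof (intro conjI ballI)
    show "?D \<noteq> {}" using dir by (simp add: directed_set_def)
    show "preorder_on ?D ?s"
      by (auto simp: preorder_on_def refl_on_def trans_def)
    fix a b assume "a \<in> ?D" "b \<in> ?D"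
    then obtain i j where ij: "i \<in> I" "j \<in> I" "a = x i" "b = x j" by blast
    then obtain k where "k \<in> I" "(i, k) \<in> r" "(j, k) \<in> r"
      using dir unfolding directed_set_def by blast
    then show "\<exists>c\<in>?D. (a, c) \<in> ?s \<and> (b, c) \<in> ?s"
      using ij by (intro bexI[of _ "x k"]) (auto intro: anti)
  qed
  have "net_decreases_to ?D ?s (\<lambda>a. a) 0"
    using dec by (auto simp: net_decreases_to_def)
  with oc ddir have lim: "((\<lambda>a. norm a) \<longlongrightarrow> 0) (tails ?D ?s)"
    by (force simp: order_continuous_norm_def)
  show ?thesis
    unfolding tendsto_iff
  proof (intro allI impI)
    fix e :: real assume "e > 0"
    then have "eventually (\<lambda>a. dist (norm a) 0 < e) (tails ?D ?s)"
      using lim by (simp add: tendsto_iff)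
    then obtain i where i: "i \<in> I" "\<And>b. b \<in> ?D \<Longrightarrow> b \<le> x i \<Longrightarrow> dist (norm b) 0 < e"
      unfolding ev[OF ddir] by auto
    then show "eventually (\<lambda>i. dist (norm (x i)) 0 < e) (tails I r)"
      unfolding ev[OF dir] using anti by blast
  qed
qed

end

(*
  Irreducibility makes P strictly positive, since the z with P|z| = 0 form a closed invariant
  ideal. Hence the fixed space of T is a sublattice; it is totally ordered, because each of its
  positive non-zero elements generates E as a closed ideal, and therefore one-dimensional. So
  P x = phi(x) y with y a quasi-interior fixed point and phi a strictly positive T-invariant
  functional. A maximal inequality of Hopf type with respect to phi, together with the decomposition
  x - P x = (h - T h) + r, where |h| is at most a multiple of y and phi(|r|) is small, shows that the
  suprema over n >= m of the truncated deviations |A_n x - P x| inf u, which exist by order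
  continuity of the norm, have phi-values tending to 0 as m grows. As phi is strictly positive, they
  decrease to 0.
*)

theory Submission
  imports Defs
begin

section \<open>Banach lattices with order continuous norm\<close>

lemma pprt_add_le: "pprt (a + b) \<le> pprt a + pprt (b::'a::lattice_ab_group_add)"
  unfolding pprt_def by (intro le_supI add_mono add_nonneg_nonneg) auto

lemma pprt_le_abs: "pprt a \<le> \<bar>a::'a::lattice_ab_group_add_abs\<bar>"
  unfolding pprt_def by (intro le_supI abs_ge_self abs_ge_zero)

lemma self_le_pprt: "a \<le> pprt (a::'a::lattice_ab_group_add)"
  by (simp add: pprt_def)

lemma pprt_diff: "a = pprt a - pprt (- (a::'a::lattice_ab_group_add))"
  using prts[of a] by (simp add: pprt_neg)

text \<open>Subtracting \<open>pprt (- a)\<close> from both arguments leaves \<open>inf a 0\<close>,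
  which is \<open>nprt a\<close> and cancels against it.\<close>

lemma inf_pprt_pprt_neg: "inf (pprt a) (pprt (- a)) = (0::'a::lattice_ab_group_add)"
proof -
  have "inf (pprt a) (pprt (- a)) = inf (pprt a - pprt (- a)) 0 + pprt (- a)"
    by (simp add: add_inf_distrib_right del: diff_inf_eq_sup)
  also have "\<dots> = nprt a + pprt (- a)"
    using pprt_diff[of a] by (simp add: nprt_def)
  finally show ?thesis by (simp add: pprt_neg)
qed

lemma diff_inf_eq_pprt: "a - inf a b = pprt (a - (b::'a::lattice_ab_group_add))"
  by (simp add: pprt_def add_sup_distrib_left sup_commute)

lemma pprt_scaleR_le:
  "0 \<le> c \<Longrightarrow> pprt (c *\<^sub>R a) \<le> c *\<^sub>R pprt (a::'a::banach_lattice)"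
  unfolding pprt_def by (intro le_supI scaleR_left_mono scaleR_nonneg_nonneg) auto

lemma abs_scaleR_le: "\<bar>c *\<^sub>R a\<bar> \<le> \<bar>c\<bar> *\<^sub>R \<bar>a::'a::banach_lattice\<bar>"
proof (rule abs_leI)
  have *: "c *\<^sub>R a \<le> \<bar>c\<bar> *\<^sub>R \<bar>a\<bar>" for c and a :: 'a
  proof (cases "0 \<le> c")
    case True
    then show ?thesis by (simp add: scaleR_left_mono abs_ge_self)
  next
    case False
    then have "(- c) *\<^sub>R (- a) \<le> (- c) *\<^sub>R \<bar>a\<bar>"
      by (intro scaleR_left_mono abs_ge_minus_self) simp
    with False show ?thesis by simp
  qed
  show "c *\<^sub>R a \<le> \<bar>c\<bar> *\<^sub>R \<bar>a\<bar>" by (rule *)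
  show "- (c *\<^sub>R a) \<le> \<bar>c\<bar> *\<^sub>R \<bar>a\<bar>" using *[of "- c" a] by simp
qed

section \<open>Norm and order; closedness of the positive cone\<close>

lemma norm_mono_nonneg: "0 \<le> a \<Longrightarrow> a \<le> b \<Longrightarrow> norm a \<le> norm (b::'a::banach_lattice)"
  by (rule norm_mono_abs) (metis abs_of_nonneg order_trans)

lemma norm_abs: "norm \<bar>a\<bar> = norm (a::'a::banach_lattice)"
  by (intro antisym norm_mono_abs) simp_all

lemma norm_pprt_le: "norm (pprt a) \<le> norm (a::'a::banach_lattice)"
  using norm_mono_nonneg[OF zero_le_pprt pprt_le_abs] by (simp add: norm_abs)

lemma norm_pprt_mono: "a \<le> b \<Longrightarrow> norm (pprt a) \<le> norm (pprt (b::'a::banach_lattice))"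
  by (intro norm_mono_nonneg pprt_mono zero_le_pprt)

lemma norm_pprt_add_le: "norm (pprt (a + b)) \<le> norm (pprt a) + norm (pprt (b::'a::banach_lattice))"
  by (rule order_trans[OF norm_mono_nonneg[OF zero_le_pprt pprt_add_le] norm_triangle_ineq])

lemma le_zero_of_norm_pprt:
  fixes a :: "'a::banach_lattice"
  assumes "\<And>e. e > 0 \<Longrightarrow> norm (pprt a) < e"
  shows "a \<le> 0"
proof -
  have "norm (pprt a) \<le> 0"
    using assms by (meson not_less order_less_irrefl)
  then show ?thesis by (simp add: le_zero_iff_zero_pprt)
qed

text \<open>From \<open>0 \<le> x n\<close> follows \<open>- l \<le> x n - l\<close>, so the norm of
  \<open>pprt (- l)\<close> is at most that of \<open>x n - l\<close>, which becomes arbitrarily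
  small.\<close>

lemma tendsto_nonneg:
  fixes x :: "nat \<Rightarrow> 'a::banach_lattice"
  assumes "x \<longlonglongrightarrow> l" and "\<And>n. n \<ge> N \<Longrightarrow> 0 \<le> x n"
  shows "0 \<le> l"
proof -
  have "- l \<le> 0"
  proof (rule le_zero_of_norm_pprt)
    fix e :: real assume "e > 0"
    with assms(1) obtain M where M: "\<And>n. n \<ge> M \<Longrightarrow> norm (x n - l) < e"
      by (meson LIMSEQ_D)
    let ?n = "max M N"
    have "pprt (- l) \<le> pprt (x ?n - l)"
      using assms(2)[of ?n] by (intro pprt_mono) (simp add: le_diff_eq)
    then have "norm (pprt (- l)) \<le> norm (x ?n - l)"
      by (meson norm_mono_nonneg norm_pprt_le order_trans zero_le_pprt)
    also have "\<dots> < e" by (rule M) simp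
    finally show "norm (pprt (- l)) < e" .
  qed
  then show ?thesis by simp
qed

lemma tendsto_le_lattice:
  fixes x :: "nat \<Rightarrow> 'a::banach_lattice"
  assumes "x \<longlonglongrightarrow> l" "z \<longlonglongrightarrow> m" and "\<And>n. n \<ge> N \<Longrightarrow> x n \<le> z n"
  shows "l \<le> m"
  using tendsto_nonneg[of "\<lambda>n. z n - x n" "m - l" N] assms
  by (simp add: tendsto_diff)

lemma archimedean_le_zero:
  fixes w v :: "'a::banach_lattice"
  assumes "\<And>n. real n *\<^sub>R w \<le> v"
  shows "w \<le> 0"
proof (rule tendsto_le_lattice)
  have "(\<lambda>n. inverse (real (Suc n)) *\<^sub>R v) \<longlonglongrightarrow> 0 *\<^sub>R v"
    by (intro tendsto_intros LIMSEQ_inverse_real_of_nat)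
  then show "(\<lambda>n. inverse (real (Suc n)) *\<^sub>R v) \<longlonglongrightarrow> 0" by simp
  show "(\<lambda>n. w) \<longlonglongrightarrow> w" by simp
  show "w \<le> inverse (real (Suc n)) *\<^sub>R v" for n
    using scaleR_left_mono[OF assms[of "Suc n"], of "inverse (real (Suc n))"] by (simp del: of_nat_Suc)
qed

lemma tendsto_abs_lattice:
  fixes x :: "nat \<Rightarrow> 'a::banach_lattice"
  assumes "x \<longlonglongrightarrow> l"
  shows "(\<lambda>n. \<bar>x n\<bar>) \<longlonglongrightarrow> \<bar>l\<bar>"
proof (rule LIM_zero_cancel, rule Lim_null_comparison)
  show "\<forall>\<^sub>F n in sequentially. norm (\<bar>x n\<bar> - \<bar>l\<bar>) \<le> norm (x n - l)"
    by (intro always_eventually allI norm_mono_abs abs_triangle_ineq3)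
  show "(\<lambda>n. norm (x n - l)) \<longlonglongrightarrow> 0"
    using assms by (simp add: tendsto_norm_zero LIM_zero)
qed

section \<open>Order continuity and suprema of sequences\<close>

lemma eventually_tails:
  assumes dir: "directed_set I r"
  shows "eventually Q (tails I r) \<longleftrightarrow> (\<exists>i\<in>I. \<forall>j\<in>I. (i, j) \<in> r \<longrightarrow> Q j)"
  unfolding tails_def
proof (subst eventually_INF_base)
  show "I \<noteq> {}" using dir by (simp add: directed_set_def)
  show "\<exists>k\<in>I. principal {j \<in> I. (k, j) \<in> r} \<le>
      inf (principal {j \<in> I. (a, j) \<in> r}) (principal {j \<in> I. (b, j) \<in> r})"
    if ab: "a \<in> I" "b \<in> I" for a b
  proof -
    obtain k where k: "k \<in> I" "(a, k) \<in> r" "(b, k) \<in> r"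
      using dir ab unfolding directed_set_def by meson
    have "trans r" using dir by (simp add: directed_set_def preorder_on_def)
    with k show ?thesis
      by (intro bexI[of _ k]) (auto dest: transD)
  qed
qed (auto simp: eventually_principal)

text \<open>
  The net \<open>v - x n\<close>, where \<open>v\<close> runs through the upper bounds of \<open>x\<close>, decreases to \<open>0\<close>: if \<open>w\<close>
  is a lower bound of it, then with \<open>v\<close> also \<open>v - w\<close> is an upper bound, hence so is every
  \<open>v - k w\<close>.
\<close>

lemma order_continuous_norm_increasing:
  fixes x :: "nat \<Rightarrow> 'a::banach_lattice"
  assumes oc: "order_continuous_norm TYPE('a)"
    and inc: "incseq x" and bd: "\<And>n. x n \<le> u"
  shows "convergent x"
proof -
  define I where "I = {v. \<forall>n. x n \<le> v} \<times> (UNIV :: nat set)"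
  define r where "r = {((v, m), (w, n)). (v, m) \<in> I \<and> (w, n) \<in> I \<and> w \<le> v \<and> m \<le> (n::nat)}"
  define f where "f = (\<lambda>(v, n). v - x n)"
  have dir: "directed_set I r"
    unfolding directed_set_def
  proof (intro conjI ballI)
    show "I \<noteq> {}" using bd by (auto simp: I_def)
    show "preorder_on I r"
      by (auto simp: preorder_on_def refl_on_def trans_def r_def)
    fix i j assume "i \<in> I" "j \<in> I"
    then show "\<exists>k\<in>I. (i, k) \<in> r \<and> (j, k) \<in> r"
      by (intro bexI[of _ "(inf (fst i) (fst j), max (snd i) (snd j))"])
        (auto simp: r_def I_def)
  qed
  have dec: "net_decreases_to I r f 0"
    unfolding net_decreases_to_def
  proof (intro conjI ballI impI)
    show "f j \<le> f i" if "(i, j) \<in> r" for i j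
      using that inc by (auto simp: f_def r_def intro!: diff_mono dest: incseqD)
    show "isGlb UNIV (f ` I) 0"
    proof (rule isGlbI2)
      show "isLb UNIV (f ` I) 0"
        by (auto simp: isLb_def setge_def f_def I_def)
      show "Collect (isLb UNIV (f ` I)) *<= 0"
      proof (rule setleI, rule ballI)
        fix w assume "w \<in> Collect (isLb UNIV (f ` I))"
        then have w: "w \<le> v - x n" if "\<And>n. x n \<le> v" for v n
          using that by (force simp: isLb_def setge_def f_def I_def)
        have "\<forall>n. x n \<le> u - real k *\<^sub>R w" for k
        proof (induction k)
          case (Suc k)
          then have "w \<le> (u - real k *\<^sub>R w) - x n" for n by (intro w) simp
          then show ?case by (simp add: algebra_simps)
        qed (use bd in simp)
        then have "real k *\<^sub>R w \<le> u - x 0" for k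
          by (simp add: algebra_simps)
        then show "w \<le> 0" by (rule archimedean_le_zero)
      qed
    qed
  qed
  have "((\<lambda>i. norm (f i)) \<longlongrightarrow> 0) (tails I r)"
    by (rule order_continuous_norm_net[OF oc dir dec])
  have "Cauchy x"
  proof (rule CauchyI')
    fix e :: real assume "e > 0"
    have "\<forall>\<^sub>F i in tails I r. norm (f i) < e"
      using \<open>((\<lambda>i. norm (f i)) \<longlongrightarrow> 0) (tails I r)\<close> \<open>e > 0\<close> by (rule order_tendstoD)
    then obtain i where i: "i \<in> I" and "\<forall>j\<in>I. (i, j) \<in> r \<longrightarrow> norm (f j) < e"
      by (auto simp: eventually_tails[OF dir])
    moreover have "(i, i) \<in> r" using i by (auto simp: r_def)
    ultimately have small: "norm (f i) < e" by blast
    obtain v n where vn: "i = (v, n)" "\<And>n. x n \<le> v" using i by (auto simp: I_def)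
    show "\<exists>M. \<forall>m\<ge>M. \<forall>k>m. dist (x m) (x k) < e"
    proof (intro exI allI impI)
      fix m k assume "n \<le> m" "m < k"
      \<comment> \<open>Both \<open>x m\<close> and \<open>x k\<close> lie between
        \<open>x n\<close> and the upper bound \<open>v\<close>, so one small member of the net
        controls all later differences.\<close>
      then have "norm (x k - x m) \<le> norm (v - x n)"
        using vn(2) by (intro norm_mono_nonneg diff_mono) (auto intro: incseqD[OF inc])
      then show "dist (x m) (x k) < e"
        using small vn(1) by (simp add: f_def dist_norm norm_minus_commute)
    qed
  qed
  then show ?thesis by (simp add: Cauchy_convergent)
qed

text \<open>Finite suprema increase and are bounded, hence converge in norm; closedness of the order
  makes the limit the least upper bound. The convergence belongs to the conclusion so that a bounded
  functional can be evaluated at \<open>Y\<close>.\<close>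

lemma order_continuous_norm_sup:
  fixes e :: "nat \<Rightarrow> 'a::banach_lattice"
  assumes oc: "order_continuous_norm TYPE('a)" and bd: "\<And>n. e n \<le> u"
  obtains Y where "\<And>n. e n \<le> Y" "\<And>v. (\<And>n. e n \<le> v) \<Longrightarrow> Y \<le> v"
    "(\<lambda>N. \<Squnion>\<^sub>f\<^sub>i\<^sub>n (e ` {..N})) \<longlonglongrightarrow> Y"
proof -
  let ?s = "\<lambda>N. \<Squnion>\<^sub>f\<^sub>i\<^sub>n (e ` {..N})"
  have "incseq ?s"
    by (rule incseq_SucI) (auto intro!: Sup_fin.subset_imp)
  moreover have le: "?s N \<le> v" if "\<And>n. e n \<le> v" for N v
    using that by (intro Sup_fin.boundedI) auto
  ultimately have "convergent ?s"
    using bd by (intro order_continuous_norm_increasing[OF oc]) auto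
  then obtain Y where Y: "?s \<longlonglongrightarrow> Y" by (auto simp: convergent_def)
  show thesis
  proof
    show "?s \<longlonglongrightarrow> Y" by (rule Y)
    show "e n \<le> Y" for n
      by (rule tendsto_le_lattice[OF tendsto_const Y, of n]) (auto intro!: Sup_fin.coboundedI)
    show "Y \<le> v" if "\<And>n. e n \<le> v" for v
      by (rule tendsto_le_lattice[OF Y tendsto_const, of 0]) (auto intro!: le that)
  qed
qed

section \<open>Positive operators and their means\<close>

lemma positive_operatorD:
  assumes "positive_operator T"
  shows "bounded_linear T" "\<And>x. 0 \<le> x \<Longrightarrow> 0 \<le> T x" "\<And>x y. x \<le> y \<Longrightarrow> T x \<le> T y"
    "\<And>x. \<bar>T x\<bar> \<le> T \<bar>x\<bar>"
proof -
  show bl: "bounded_linear T" and pos: "\<And>x. 0 \<le> x \<Longrightarrow> 0 \<le> T x"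
    using assms by (auto simp: positive_operator_def)
  interpret bounded_linear T by (rule bl)
  show mono: "\<And>x y. x \<le> y \<Longrightarrow> T x \<le> T y"
    using pos by (metis diff diff_ge_0_iff_ge)
  show "\<And>x. \<bar>T x\<bar> \<le> T \<bar>x\<bar>"
    by (intro abs_leI) (auto simp flip: neg intro!: mono abs_ge_self abs_ge_minus_self)
qed

lemma positive_operator_funpow:
  assumes "positive_operator T"
  shows "positive_operator (T ^^ n)"
proof (induction n)
  case 0
  then show ?case by (simp add: positive_operator_def)
next
  case (Suc n)
  with assms show ?case
    using bounded_linear_compose[of T "T ^^ n"]
    by (auto simp: positive_operator_def o_def)
qed

lemma positive_operator_cesaro_mean:
  assumes "positive_operator T"
  shows "positive_operator (cesaro_mean T n)"
  unfolding positive_operator_def cesaro_mean_def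
  using positive_operator_funpow[OF assms]
  by (intro conjI allI impI bounded_linear_sum bounded_linear_scaleR_right[THEN bounded_linear_compose]
      scaleR_nonneg_nonneg sum_nonneg) (auto simp: positive_operator_def)

section \<open>Means of fixed points and coboundaries\<close>

lemma cesaro_mean_fixed:
  assumes "T x = x" "n > 0"
  shows "cesaro_mean T n x = x"
proof -
  have "(T ^^ k) x = x" for k by (induction k) (auto simp: assms)
  with \<open>n > 0\<close> show ?thesis by (simp add: cesaro_mean_def sum_constant_scaleR)
qed

lemma cesaro_mean_coboundary:
  assumes "linear T"
  shows "cesaro_mean T n (h - T h) = (1 / real n) *\<^sub>R (h - (T ^^ n) h)"
proof -
  have "linear (T ^^ k)" for k
    by (induction k) (use assms in \<open>auto intro: linear_compose[unfolded o_def] bounded_linear.linear[OF bounded_linear_ident]\<close>)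
  then have "(\<Sum>k<n. (T ^^ k) (h - T h)) = (\<Sum>k<n. (T ^^ k) h - (T ^^ Suc k) h)"
    by (intro sum.cong refl) (simp add: linear_diff funpow_swap1)
  also have "\<dots> = h - (T ^^ n) h"
    by (subst sum_lessThan_telescope') simp
  finally show ?thesis by (simp add: cesaro_mean_def)
qed

text \<open>Each \<open>x - (T ^^ k) x\<close> is the coboundary of the partial sum
  \<open>\<Sum>j<k. (T ^^ j) x\<close>; averaging over \<open>k < n\<close> gives
  \<open>h\<close>.\<close>

lemma diff_cesaro_mean_coboundary:
  assumes "linear T" "n > 0"
  obtains h where "x - cesaro_mean T n x = h - T h"
proof -
  interpret linear T by fact
  let ?G = "\<lambda>k. \<Sum>j<k. (T ^^ j) x"
  have G: "?G k - T (?G k) = x - (T ^^ k) x" for k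
  proof (induction k)
    case (Suc k)
    have "?G (Suc k) - T (?G (Suc k)) = (?G k - T (?G k)) + ((T ^^ k) x - (T ^^ Suc k) x)"
      by (simp add: add)
    then show ?case by (simp add: Suc)
  qed (simp add: zero)
  let ?h = "(1 / real n) *\<^sub>R (\<Sum>k<n. ?G k)"
  have "?h - T ?h = (1 / real n) *\<^sub>R (\<Sum>k<n. ?G k - T (?G k))"
    by (simp add: scaleR sum sum_subtractf scaleR_diff_right)
  also have "\<dots> = (1 / real n) *\<^sub>R (\<Sum>k<n. x) - cesaro_mean T n x"
    by (simp only: G sum_subtractf scaleR_diff_right cesaro_mean_def)
  also have "\<dots> = x - cesaro_mean T n x"
    using \<open>n > 0\<close> by (simp add: sum_constant_scaleR)
  finally show thesis using that by metis
qed

section \<open>A maximal inequality\<close>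

text \<open>Replaces the maximum of 0 and the first \<open>n\<close> partial sums in Hopf's
  argument. As \<open>T\<close> need not preserve suprema, that maximum satisfies the recursion only
  as an inequality; the iterate satisfies it exactly and dominates the maximum.\<close>

definition maximal_iterate :: "('a::banach_lattice \<Rightarrow> 'a) \<Rightarrow> 'a \<Rightarrow> nat \<Rightarrow> 'a" where
  "maximal_iterate T f n = ((\<lambda>m. pprt (f + T m)) ^^ n) 0"

lemma maximal_iterate_0 [simp]: "maximal_iterate T f 0 = 0"
  and maximal_iterate_Suc:
    "maximal_iterate T f (Suc n) = pprt (f + T (maximal_iterate T f n))"
  by (simp_all add: maximal_iterate_def)

lemma maximal_iterate_nonneg: "0 \<le> maximal_iterate T f n"
  by (cases n) (simp_all add: maximal_iterate_Suc)

lemma incseq_maximal_iterate: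
  assumes "positive_operator T"
  shows "incseq (maximal_iterate T f)"
proof (rule incseq_SucI)
  show "maximal_iterate T f n \<le> maximal_iterate T f (Suc n)" for n
  proof (induction n)
    case (Suc n)
    then show ?case
      by (subst (1 2) maximal_iterate_Suc) (intro pprt_mono add_left_mono positive_operatorD(3)[OF assms])
  qed (simp add: maximal_iterate_nonneg)
qed

lemma sum_le_maximal_iterate:
  assumes "positive_operator T"
  shows "(\<Sum>k<n. (T ^^ k) f) \<le> maximal_iterate T f n"
proof (induction n)
  case (Suc n)
  interpret bounded_linear T using positive_operatorD(1)[OF assms] .
  have "(\<Sum>k<Suc n. (T ^^ k) f) = f + T (\<Sum>k<n. (T ^^ k) f)"
    by (subst sum.lessThan_Suc_shift) (simp add: sum)
  also have "\<dots> \<le> f + T (maximal_iterate T f n)"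
    by (intro add_left_mono positive_operatorD(3)[OF assms] Suc)
  also have "\<dots> \<le> maximal_iterate T f (Suc n)"
    by (simp add: maximal_iterate_Suc self_le_pprt)
  finally show ?case .
qed simp

text \<open>After division by \<open>c\<close>, the element \<open>a\<close> lies below both
  \<open>pprt v\<close> and \<open>pprt (- v)\<close>, whose infimum is 0.\<close>

lemma le_zero_of_le_scaled_pprts:
  fixes a v :: "'a::banach_lattice"
  assumes "a \<le> pprt (- v)" "a \<le> c *\<^sub>R pprt v" "c \<ge> 1"
  shows "a \<le> 0"
proof -
  have c: "c > 0" using assms(3) by simp
  have "pprt (- v) \<le> c *\<^sub>R pprt (- v)"
    using scaleR_right_mono[of 1 c "pprt (- v)"] assms(3) by simp
  with assms(1) have "a \<le> c *\<^sub>R pprt (- v)" by (rule order_trans)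
  moreover have "inverse c *\<^sub>R a \<le> b" if "a \<le> c *\<^sub>R b" for b
    using scaleR_left_mono[OF that, of "inverse c"] c by simp
  ultimately have "inverse c *\<^sub>R a \<le> inf (pprt v) (pprt (- v))"
    using assms(2) by simp
  then have "inverse c *\<^sub>R a \<le> 0" by (simp add: inf_pprt_pprt_neg)
  from scaleR_left_mono[OF this, of c] show ?thesis using c by simp
qed

text \<open>Abstract form of a measure-preserving system: \<open>\<phi>\<close> plays the integral
  and \<open>y\<close> the constant function one.\<close>

locale invariant_pair =
  fixes T :: "'a::banach_lattice \<Rightarrow> 'a" and \<phi> :: "'a \<Rightarrow> real" and y :: 'a
  assumes T: "positive_operator T"
    and phi: "bounded_linear \<phi>"
    and phi_nonneg: "0 \<le> x \<Longrightarrow> 0 \<le> \<phi> x"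
    and phi_T: "\<phi> (T x) = \<phi> x"
    and y_nonneg: "0 \<le> y"
    and T_y: "T y = y"
begin

sublocale T: bounded_linear T
  using positive_operatorD(1)[OF T] .

sublocale phi: bounded_linear \<phi>
  by (rule phi)

lemma phi_mono: "x \<le> z \<Longrightarrow> \<phi> x \<le> \<phi> z"
  using phi_nonneg[of "z - x"] by (simp add: phi.diff)

lemma funpow_y [simp]: "(T ^^ n) y = y"
  by (induction n) (auto simp: T_y)

text \<open>
  A form of Hopf's maximal inequality that avoids band projections. Put
  \<open>v = g - t y + T M\<close>; then \<open>M \<le> pprt v\<close>, so that the difference \<open>a\<close> of the two sides of \<open>le\<close>
  below is dominated both by \<open>pprt (- v)\<close> and by a multiple of \<open>pprt v\<close>, which are disjoint.
\<close>

lemma maximal_inequality: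
  fixes n :: nat
  assumes "t > 0" "c > 0" "0 \<le> g"
  defines "M \<equiv> maximal_iterate T (g - t *\<^sub>R y) n"
  shows "\<phi> (inf M (c *\<^sub>R y)) \<le> c / t * \<phi> g"
proof -
  define v where "v = g - t *\<^sub>R y + T M"
  define a where "a = M + (t / c) *\<^sub>R inf M (c *\<^sub>R y) - (g + T M)"
  have M0: "0 \<le> M" by (simp add: M_def maximal_iterate_nonneg)
  \<comment> \<open>By the recursion \<open>pprt v\<close> is the next iterate, and the iterates
    increase.\<close>
  have Mv: "M \<le> pprt v"
    using incseq_SucD[OF incseq_maximal_iterate[OF T], of "g - t *\<^sub>R y" n]
    by (simp add: M_def v_def maximal_iterate_Suc)
  have 1: "(t / c) *\<^sub>R inf M (c *\<^sub>R y) \<le> t *\<^sub>R y"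
    using scaleR_left_mono[of "inf M (c *\<^sub>R y)" "c *\<^sub>R y" "t / c"] assms(1,2) by simp
  have 2: "(t / c) *\<^sub>R inf M (c *\<^sub>R y) \<le> (t / c) *\<^sub>R M"
    using assms(1,2) by (intro scaleR_left_mono) auto
  have le: "M + (t / c) *\<^sub>R inf M (c *\<^sub>R y) \<le> g + T M"
  proof -
    have "a \<le> pprt (- v)"
    proof -
      have "a \<le> pprt v + t *\<^sub>R y - (g + T M)"
        unfolding a_def by (intro diff_right_mono add_mono Mv 1)
      also have "\<dots> = pprt v - v" by (simp add: v_def)
      also have "\<dots> = pprt (- v)" using pprt_diff[of v] by (simp add: algebra_simps)
      finally show ?thesis .
    qed
    moreover have "a \<le> (1 + t / c) *\<^sub>R pprt v"
    proof -
      have "a \<le> M + (t / c) *\<^sub>R inf M (c *\<^sub>R y)"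
        unfolding a_def
        using diff_left_mono[OF add_nonneg_nonneg[OF assms(3) positive_operatorD(2)[OF T M0]]]
        by (metis diff_zero)
      also have "\<dots> \<le> (1 + t / c) *\<^sub>R M"
        using 2 by (simp add: scaleR_add_left)
      also have "\<dots> \<le> (1 + t / c) *\<^sub>R pprt v"
        using assms(1,2) by (intro scaleR_left_mono Mv) simp
      finally show ?thesis .
    qed
    ultimately have "a \<le> 0"
      using assms(1,2) by (intro le_zero_of_le_scaled_pprts[of a v "1 + t / c"]) simp_all
    then show ?thesis by (simp add: a_def)
  qed
  \<comment> \<open>Invariance gives \<open>\<phi> (T M) = \<phi> M\<close>, so these terms cancel
    under \<open>\<phi>\<close>.\<close>
  have "(t / c) * \<phi> (inf M (c *\<^sub>R y)) \<le> \<phi> g"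
    using phi_mono[OF le] by (simp add: phi.add phi.scaleR phi_T)
  then show ?thesis
    using assms(1,2) by (simp add: field_simps)
qed

end

section \<open>Convergence relative to an invariant functional\<close>

text \<open>Both \<open>a + m + p\<close> and \<open>a + c + p\<close> dominate the left side, and
  translations pass through the infimum. This exchanges the truncation level \<open>u\<close> for a
  level \<open>c\<close> fit for the maximal inequality.\<close>

lemma inf_le_add_add:
  fixes z u :: "'a::lattice_ab_group_add"
  assumes "z \<le> a + m" "u \<le> c + p" "0 \<le> a" "0 \<le> p"
  shows "inf z u \<le> a + inf m c + p"
proof -
  have "inf z u \<le> (a + m) + p"
    using assms(1,4) by (meson add_increasing2 le_infI1)
  moreover have "inf z u \<le> a + (c + p)"
    using assms(2,3) by (meson add_increasing le_infI2)
  ultimately have "inf z u \<le> inf (a + m + p) (a + c + p)"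
    by (simp add: add.assoc)
  then show ?thesis
    by (simp only: add_inf_distrib_left add_inf_distrib_right)
qed

text \<open>\<open>approx\<close> makes \<open>y\<close> quasi-interior: the part of
  \<open>|x|\<close> above a large multiple of \<open>y\<close> is small in norm.
  \<open>means\<close> says that the mean ergodic projection has rank one.\<close>

locale ergodic_pair = invariant_pair +
  assumes phi_y: "\<phi> y = 1"
    and phi_strict: "0 \<le> x \<Longrightarrow> \<phi> x = 0 \<Longrightarrow> x = 0"
    and approx: "e > 0 \<Longrightarrow> \<exists>c>0. norm (pprt (\<bar>x\<bar> - c *\<^sub>R y)) < e"
    and means: "(\<lambda>n. cesaro_mean T n x) \<longlonglongrightarrow> \<phi> x *\<^sub>R y"
begin

text \<open>The positive and the negative part of \<open>x\<close> are truncated separately at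
  \<open>c *\<^sub>R y\<close>. A difference of two elements of \<open>[0, c y]\<close> has modulus
  at most \<open>c y\<close>, and each truncation costs less than \<open>e / 2\<close>.\<close>

lemma bounded_approximation:
  assumes "e > 0"
  obtains h c where "c > 0" "\<bar>h\<bar> \<le> c *\<^sub>R y" "norm (x - h) < e"
proof -
  obtain c where c: "c > 0" "norm (pprt (\<bar>x\<bar> - c *\<^sub>R y)) < e / 2"
    using approx[of "e / 2" x] assms by auto
  let ?d = "c *\<^sub>R y"
  define p q where "p = pprt x" and "q = pprt (- x)"
  define h where "h = inf p ?d - inf q ?d"
  have d0: "0 \<le> ?d" using c y_nonneg by (simp add: scaleR_nonneg_nonneg)
  have pq0: "0 \<le> p" "0 \<le> q" "p \<le> \<bar>x\<bar>" "q \<le> \<bar>x\<bar>"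
    using pprt_le_abs[of x] pprt_le_abs[of "- x"] by (simp_all add: p_def q_def)
  show thesis
  proof
    have "inf p ?d - inf q ?d \<le> ?d - 0" "inf q ?d - inf p ?d \<le> ?d - 0"
      by (intro diff_mono; use pq0 d0 in simp)+
    then show "\<bar>h\<bar> \<le> ?d"
      unfolding h_def by (intro abs_leI) (simp_all del: diff_inf_eq_sup)
    have "x - h = (p - inf p ?d) - (q - inf q ?d)"
      using pprt_diff[of x] by (simp add: h_def p_def q_def algebra_simps del: diff_inf_eq_sup)
    then have "norm (x - h) \<le> norm (pprt (p - ?d)) + norm (pprt (q - ?d))"
      unfolding diff_inf_eq_pprt by (simp add: norm_triangle_ineq4)
    also have "\<dots> \<le> norm (pprt (\<bar>x\<bar> - ?d)) + norm (pprt (\<bar>x\<bar> - ?d))"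
      using pq0 by (intro add_mono norm_mono_nonneg pprt_mono diff_right_mono) auto
    also have "\<dots> < e" using c by simp
    finally show "norm (x - h) < e" .
  qed (rule c)
qed

text \<open>For large \<open>n\<close> the element \<open>\<phi> x *\<^sub>R y\<close> is close to
  the mean of \<open>x\<close>, and \<open>x\<close> minus that mean is a coboundary of some
  \<open>h0\<close>. Replacing \<open>h0\<close> by a nearby \<open>h\<close> bounded by a multiple
  of \<open>y\<close> leaves a remainder of three terms, each with \<open>\<phi>\<close>-value below
  \<open>\<delta> / 4\<close>.\<close>

lemma coboundary_decomposition:
  assumes "\<delta> > 0"
  obtains h r c where "c > 0" "\<bar>h\<bar> \<le> c *\<^sub>R y" "x - \<phi> x *\<^sub>R y = (h - T h) + r" "\<phi> \<bar>r\<bar> < \<delta>"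
proof -
  obtain K where K: "K > 0" "\<And>z. \<bar>\<phi> z\<bar> \<le> norm z * K"
    using phi.pos_bounded by auto
  have phi_le: "\<phi> \<bar>z\<bar> < \<delta> / 4" if "norm z < \<delta> / (4 * K)" for z
  proof -
    have "\<phi> \<bar>z\<bar> \<le> norm z * K" using K(2)[of "\<bar>z\<bar>"] by (simp add: norm_abs)
    also have "\<dots> < \<delta> / 4" using that K(1) by (simp add: field_simps)
    finally show ?thesis .
  qed
  have pos: "\<delta> / (4 * K) > 0" using assms K by simp
  obtain N where N: "\<And>n. n \<ge> N \<Longrightarrow> norm (cesaro_mean T n x - \<phi> x *\<^sub>R y) < \<delta> / (4 * K)"
    using LIMSEQ_D[OF means pos] by metis
  \<comment> \<open>\<open>Suc N\<close> rather than \<open>N\<close> guarantees a mean of at least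
    one term.\<close>
  let ?z = "cesaro_mean T (Suc N) x - \<phi> x *\<^sub>R y"
  obtain h0 where h0: "x - cesaro_mean T (Suc N) x = h0 - T h0"
    using diff_cesaro_mean_coboundary[OF T.linear_axioms zero_less_Suc] by metis
  obtain h c where h: "c > 0" "\<bar>h\<bar> \<le> c *\<^sub>R y" "norm (h0 - h) < \<delta> / (4 * K)"
    using bounded_approximation[OF pos] by metis
  let ?r = "?z + (h0 - h) - T (h0 - h)"
  show thesis
  proof
    show "x - \<phi> x *\<^sub>R y = (h - T h) + ?r"
      using h0 by (simp add: T.diff algebra_simps)
    have "\<bar>?r\<bar> \<le> \<bar>?z\<bar> + \<bar>h0 - h\<bar> + \<bar>T (h0 - h)\<bar>"
      by (meson abs_triangle_ineq abs_triangle_ineq4 add_right_mono order_trans)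
    also have "\<dots> \<le> \<bar>?z\<bar> + \<bar>h0 - h\<bar> + T \<bar>h0 - h\<bar>"
      by (intro add_left_mono positive_operatorD(4)[OF T])
    finally have "\<phi> \<bar>?r\<bar> \<le> \<phi> \<bar>?z\<bar> + \<phi> \<bar>h0 - h\<bar> + \<phi> \<bar>h0 - h\<bar>"
      using phi_mono by (fastforce simp: phi.add phi_T)
    also have "\<dots> < \<delta>"
      using phi_le[OF N[of "Suc N"]] phi_le[OF h(3)] assms by simp
    finally show "\<phi> \<bar>?r\<bar> < \<delta>" .
  qed (use h in auto)
qed

text \<open>The partial sums of \<open>g - t *\<^sub>R y\<close> lie below the iterates, dividing by
  \<open>m\<close> only helps, and the mean fixes \<open>y\<close>. One iterate serves all
  \<open>m \<le> N\<close>.\<close>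

lemma cesaro_mean_le_maximal_iterate:
  assumes "0 < m" "m \<le> N"
  shows "cesaro_mean T m g \<le> t *\<^sub>R y + maximal_iterate T (g - t *\<^sub>R y) N"
proof -
  let ?f = "g - t *\<^sub>R y" and ?M = "maximal_iterate T (g - t *\<^sub>R y)"
  interpret A: bounded_linear "cesaro_mean T m"
    using positive_operatorD(1)[OF positive_operator_cesaro_mean[OF T]] .
  have "cesaro_mean T m ?f \<le> (1 / real m) *\<^sub>R ?M m"
    unfolding cesaro_mean_def by (intro scaleR_left_mono sum_le_maximal_iterate T) simp
  also have "\<dots> \<le> 1 *\<^sub>R ?M m"
    using assms(1) by (intro scaleR_right_mono maximal_iterate_nonneg) simp
  also have "\<dots> \<le> ?M N"
    using incseqD[OF incseq_maximal_iterate[OF T] assms(2)] by simp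
  finally show ?thesis
    using assms(1) by (simp add: A.diff A.scaleR cesaro_mean_fixed[of T, OF T_y] algebra_simps)
qed

text \<open>The coboundary contributes \<open>2 * C / m\<close>, the remainder \<open>r\<close>
  contributes \<open>t\<close> and the maximal iterate, and the change of truncation level from
  \<open>u\<close> to \<open>c *\<^sub>R y\<close> the last term. The iterate depends on
  \<open>N\<close> but not on \<open>m\<close>.\<close>

lemma truncated_deviation_le:
  assumes decomp: "x - \<phi> x *\<^sub>R y = (h - T h) + r" and h: "\<bar>h\<bar> \<le> C *\<^sub>R y" and "C > 0" "t > 0"
    and m: "0 < m" "m \<le> N"
  shows "inf \<bar>cesaro_mean T m x - \<phi> x *\<^sub>R y\<bar> u \<le>
    (2 * C / real m + t) *\<^sub>R y + inf (maximal_iterate T (\<bar>r\<bar> - t *\<^sub>R y) N) (c *\<^sub>R y) + pprt (u - c *\<^sub>R y)"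
proof (rule inf_le_add_add)
  let ?A = "cesaro_mean T m" and ?M = "maximal_iterate T (\<bar>r\<bar> - t *\<^sub>R y) N"
  have A: "positive_operator ?A" by (rule positive_operator_cesaro_mean[OF T])
  interpret A: bounded_linear ?A using positive_operatorD(1)[OF A] .
  have Tm: "positive_operator (T ^^ m)" by (rule positive_operator_funpow[OF T])
  interpret Tm: bounded_linear "T ^^ m" using positive_operatorD(1)[OF Tm] .
  have "\<bar>(T ^^ m) h\<bar> \<le> C *\<^sub>R y"
    using order_trans[OF positive_operatorD(4)[OF Tm] positive_operatorD(3)[OF Tm h]]
    by (simp add: Tm.scaleR)
  then have "\<bar>h - (T ^^ m) h\<bar> \<le> C *\<^sub>R y + C *\<^sub>R y"
    by (rule order_trans[OF abs_triangle_ineq4 add_mono[OF h]])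
  then have "\<bar>h - (T ^^ m) h\<bar> \<le> (2 * C) *\<^sub>R y"
    by (simp flip: scaleR_add_left)
  then have "(1 / real m) *\<^sub>R \<bar>h - (T ^^ m) h\<bar> \<le> (2 * C / real m) *\<^sub>R y"
    using scaleR_left_mono[of "\<bar>h - (T ^^ m) h\<bar>" "(2 * C) *\<^sub>R y" "1 / real m"] by simp
  then have 1: "\<bar>?A (h - T h)\<bar> \<le> (2 * C / real m) *\<^sub>R y"
    unfolding cesaro_mean_coboundary[OF T.linear_axioms]
    using abs_scaleR_le[of "1 / real m" "h - (T ^^ m) h"] by simp
  have 2: "\<bar>?A r\<bar> \<le> t *\<^sub>R y + ?M"
    by (rule order_trans[OF positive_operatorD(4)[OF A] cesaro_mean_le_maximal_iterate[OF m]])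
  have "?A x - \<phi> x *\<^sub>R y = ?A (x - \<phi> x *\<^sub>R y)"
    using m by (simp add: A.diff A.scaleR cesaro_mean_fixed[of T, OF T_y])
  also have "\<dots> = ?A (h - T h) + ?A r"
    by (simp only: decomp A.add)
  finally have "\<bar>?A x - \<phi> x *\<^sub>R y\<bar> \<le> (2 * C / real m) *\<^sub>R y + (t *\<^sub>R y + ?M)"
    using abs_triangle_ineq[of "?A (h - T h)" "?A r"] add_mono[OF 1 2] by simp
  then show "\<bar>?A x - \<phi> x *\<^sub>R y\<bar> \<le> (2 * C / real m + t) *\<^sub>R y + ?M"
    by (simp add: scaleR_add_left add.assoc)
  show "u \<le> c *\<^sub>R y + pprt (u - c *\<^sub>R y)"
    using self_le_pprt[of "u - c *\<^sub>R y"] by (simp add: algebra_simps)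
  show "0 \<le> (2 * C / real m + t) *\<^sub>R y"
    using assms(3,4) y_nonneg by (intro scaleR_nonneg_nonneg) auto
qed simp

theorem uo_convergent_cesaro_mean:
  assumes oc: "order_continuous_norm TYPE('a)"
  shows "uo_convergent_to (\<lambda>n. cesaro_mean T (Suc n) x) (\<phi> x *\<^sub>R y)"
  unfolding uo_convergent_to_def
proof (intro allI impI)
  fix u :: 'a assume u: "0 \<le> u"
  \<comment> \<open>\<open>Suc n\<close> skips the mean of no terms, whose value is the default
    0.\<close>
  let ?e = "\<lambda>n. inf \<bar>cesaro_mean T (Suc n) x - \<phi> x *\<^sub>R y\<bar> u"
  let ?s = "\<lambda>n N. \<Squnion>\<^sub>f\<^sub>i\<^sub>n ((\<lambda>k. ?e (n + k)) ` {..N})"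
  \<comment> \<open>The tail suprema \<open>Y n\<close> are to be the decreasing majorants that
    order convergence asks for.\<close>
  have "\<exists>Y. (\<forall>k. ?e (n + k) \<le> Y) \<and> (\<forall>v. (\<forall>k. ?e (n + k) \<le> v) \<longrightarrow> Y \<le> v) \<and> ?s n \<longlonglongrightarrow> Y" for n
    by (rule order_continuous_norm_sup[OF oc, of "\<lambda>k. ?e (n + k)" u]) auto
  then obtain Y where Y: "\<And>n k. ?e (n + k) \<le> Y n"
      "\<And>n v. (\<And>k. ?e (n + k) \<le> v) \<Longrightarrow> Y n \<le> v" "\<And>n. ?s n \<longlonglongrightarrow> Y n"
    by metis
  have e_nonneg: "0 \<le> ?e n" for n using u by simp
  have Y_nonneg: "0 \<le> Y n" for n using order_trans[OF e_nonneg Y(1)[of n 0]] by simp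
  have small: "\<exists>n. \<phi> (Y n) \<le> \<epsilon>" if "\<epsilon> > 0" for \<epsilon>
  proof -
    obtain K where K: "K > 0" "\<And>z. \<bar>\<phi> z\<bar> \<le> norm z * K"
      using phi.pos_bounded by auto
    \<comment> \<open>Coboundary, threshold, maximal term and truncation will contribute at most
      \<open>t\<close> each.\<close>
    define t where "t = \<epsilon> / 4"
    have l: "t > 0" using that by (simp add: t_def)
    obtain c where c: "c > 0" "norm (pprt (\<bar>u\<bar> - c *\<^sub>R y)) < t / K"
      using approx[of "t / K" u] l K(1) by auto
    have "\<phi> (pprt (u - c *\<^sub>R y)) \<le> norm (pprt (u - c *\<^sub>R y)) * K"
      using K(2) by (meson abs_le_D1)
    also have "\<dots> \<le> t"
      using c u K(1) by (simp add: field_simps)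
    finally have u_small: "\<phi> (pprt (u - c *\<^sub>R y)) \<le> t" .
    \<comment> \<open>The level \<open>c\<close> is fixed before the decomposition, so the remainder
      can be chosen small enough to absorb the factor \<open>c / t\<close> of the maximal
      inequality.\<close>
    have "t * t / c > 0" using l c(1) by simp
    from coboundary_decomposition[OF this, of x]
    obtain h r C where hr: "C > 0" "\<bar>h\<bar> \<le> C *\<^sub>R y" "x - \<phi> x *\<^sub>R y = (h - T h) + r"
        and r: "\<phi> \<bar>r\<bar> < t * t / c"
      by metis
    obtain n where n: "2 * C / t < real n"
      using reals_Archimedean2 by blast
    have "\<phi> (?s n N) \<le> \<epsilon>" for N
    proof -
      \<comment> \<open>This iterate controls all means of index \<open>Suc (n + k)\<close> with
        \<open>k \<le> N\<close>, while the bound on its truncated \<open>\<phi>\<close>-value does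
        not involve \<open>N\<close>.\<close>
      let ?M = "maximal_iterate T (\<bar>r\<bar> - t *\<^sub>R y) (Suc (n + N))"
      let ?b = "(2 * C / real (Suc n) + t) *\<^sub>R y + inf ?M (c *\<^sub>R y) + pprt (u - c *\<^sub>R y)"
      have "?e (n + k) \<le> ?b" if "k \<le> N" for k
      proof -
        have "?e (n + k) \<le> (2 * C / real (Suc (n + k)) + t) *\<^sub>R y + inf ?M (c *\<^sub>R y) + pprt (u - c *\<^sub>R y)"
          using that by (intro truncated_deviation_le[OF hr(3,2,1) l]) auto
        also have "\<dots> \<le> ?b"
          using hr(1) y_nonneg
          by (intro add_right_mono scaleR_right_mono divide_left_mono) auto
        finally show ?thesis .
      qed
      then have "?s n N \<le> ?b"
        by (intro Sup_fin.boundedI) auto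
      from phi_mono[OF this] have "\<phi> (?s n N) \<le> 2 * C / real (Suc n) + t + \<phi> (inf ?M (c *\<^sub>R y)) + \<phi> (pprt (u - c *\<^sub>R y))"
        by (simp only: phi.add phi.scaleR phi_y real_scaleR_def mult_1_right)
      also have "2 * C / real (Suc n) \<le> t"
        using n l by (simp add: field_simps)
      also have "\<phi> (inf ?M (c *\<^sub>R y)) \<le> c / t * \<phi> \<bar>r\<bar>"
        by (rule maximal_inequality) (use l c in auto)
      also have "c / t * \<phi> \<bar>r\<bar> \<le> t"
        using r l c(1) by (simp add: field_simps)
      finally show ?thesis
        using u_small by (simp add: t_def)
    qed
    moreover have "(\<lambda>N. \<phi> (?s n N)) \<longlonglongrightarrow> \<phi> (Y n)"
      by (intro phi.tendsto Y)
    ultimately have "\<phi> (Y n) \<le> \<epsilon>"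
      by (intro LIMSEQ_le_const2) auto
    then show ?thesis ..
  qed
  show "order_convergent_to ?e 0"
    unfolding order_convergent_to_def
  proof (intro exI[of _ Y] conjI allI)
    show "decseq Y"
    proof (intro decseq_SucI Y(2))
      show "?e (Suc n + k) \<le> Y n" for n k
        using Y(1)[of n "Suc k"] by simp
    qed
    show "\<bar>?e n - 0\<bar> \<le> Y n" for n
      using Y(1)[of n 0] e_nonneg by simp
    show "isGlb UNIV (range Y) 0"
    proof (rule isGlbI2)
      show "isLb UNIV (range Y) 0"
        by (auto simp: isLb_def setge_def Y_nonneg)
      show "Collect (isLb UNIV (range Y)) *<= 0"
      proof (rule setleI, rule ballI)
        fix w assume "w \<in> Collect (isLb UNIV (range Y))"
        \<comment> \<open>As each \<open>Y n\<close> is nonnegative, \<open>pprt w\<close> is a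
          lower bound too, and strict positivity of \<open>\<phi>\<close> applies to it.\<close>
        then have "pprt w \<le> Y n" for n
          using Y_nonneg by (auto simp: isLb_def setge_def pprt_def)
        then have "\<phi> (pprt w) \<le> \<epsilon>" if "\<epsilon> > 0" for \<epsilon>
          using small[OF that] phi_mono by (meson order_trans)
        then have "\<phi> (pprt w) \<le> 0"
          by (rule field_le_epsilon) simp
        then have "\<phi> (pprt w) = 0"
          using phi_nonneg[OF zero_le_pprt] by (intro antisym)
        then show "w \<le> 0"
          using phi_strict[OF zero_le_pprt] le_zero_iff_zero_pprt by blast
      qed
    qed
  qed
qed

end

section \<open>Irreducible mean ergodic operators\<close>

locale mean_ergodic_operator =
  fixes T :: "'a::banach_lattice \<Rightarrow> 'a"
  assumes T: "positive_operator T"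
    and bounded: "power_bounded T"
    and ergodic: "mean_ergodic T"
begin

sublocale T: bounded_linear T
  using positive_operatorD(1)[OF T] .

abbreviation A where "A \<equiv> cesaro_mean T"
abbreviation P where "P \<equiv> mean_ergodic_projection T"

section \<open>The mean ergodic projection\<close>

lemma tendsto_P: "(\<lambda>n. A n x) \<longlonglongrightarrow> P x"
  using ergodic by (auto simp: mean_ergodic_def mean_ergodic_projection_def convergent_LIMSEQ_iff)

lemma A_bounded_linear: "bounded_linear (A n)"
  using positive_operatorD(1)[OF positive_operator_cesaro_mean[OF T]] .

lemma powers_bounded: "\<exists>K>0. \<forall>n x. norm ((T ^^ n) x) \<le> K * norm x"
proof -
  obtain K where K: "\<And>n. onorm (T ^^ n) \<le> K"
    using bounded by (auto simp: power_bounded_def bdd_above_def)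
  have "norm ((T ^^ n) x) \<le> max K 1 * norm x" for n x
  proof -
    have "norm ((T ^^ n) x) \<le> onorm (T ^^ n) * norm x"
      by (intro onorm positive_operatorD(1) positive_operator_funpow T)
    also have "\<dots> \<le> max K 1 * norm x"
      using K[of n] by (intro mult_right_mono) auto
    finally show ?thesis .
  qed
  then show ?thesis by (intro exI[of _ "max K 1"]) auto
qed

lemma P_bounded_linear: "bounded_linear P"
proof -
  obtain K where K: "K > 0" "\<And>n x. norm ((T ^^ n) x) \<le> K * norm x"
    using powers_bounded by auto
  have "norm (A n x) \<le> norm x * K" if "n > 0" for n x
  proof -
    have "norm (A n x) \<le> (1 / real n) * (\<Sum>k<n. K * norm x)"
      unfolding cesaro_mean_def norm_scaleR using K(2)
      by (intro mult_mono sum_norm_le) (auto intro: sum_nonneg)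
    then show ?thesis using that by (simp add: mult.commute)
  qed
  then have "norm (P x) \<le> norm x * K" for x
    by (intro LIMSEQ_le_const2[OF tendsto_norm[OF tendsto_P]] exI[of _ 1]) auto
  moreover have "P (x + z) = P x + P z" for x z
    using tendsto_add[OF tendsto_P tendsto_P, of x z] LIMSEQ_unique[OF tendsto_P]
    by (simp add: linear_simps[OF A_bounded_linear])
  moreover have "P (c *\<^sub>R x) = c *\<^sub>R P x" for c x
    using tendsto_scaleR[OF tendsto_const tendsto_P, of c x] LIMSEQ_unique[OF tendsto_P]
    by (simp add: linear_simps[OF A_bounded_linear])
  ultimately show ?thesis by (intro bounded_linear_intro)
qed

sublocale P: bounded_linear P
  by (rule P_bounded_linear)

lemma P_positive: "positive_operator P"
  using P_bounded_linear tendsto_nonneg[OF tendsto_P]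
    positive_operatorD(2)[OF positive_operator_cesaro_mean[OF T]]
  by (auto simp: positive_operator_def)

lemma P_nonneg: "0 \<le> x \<Longrightarrow> 0 \<le> P x"
  by (rule positive_operatorD(2)[OF P_positive])

lemma P_mono: "x \<le> z \<Longrightarrow> P x \<le> P z"
  by (rule positive_operatorD(3)[OF P_positive])

text \<open>The mean of \<open>x - T x\<close> telescopes to \<open>x - (T ^^ n) x\<close> divided
  by \<open>n\<close>, which tends to 0 because the powers are bounded.\<close>

lemma P_T: "P (T x) = P x"
proof -
  obtain K where K: "K > 0" "\<And>n x. norm ((T ^^ n) x) \<le> K * norm x"
    using powers_bounded by auto
  have "(\<lambda>n. A n (x - T x)) \<longlonglongrightarrow> 0"
  proof (rule Lim_null_comparison)
    have "norm (x - (T ^^ n) x) \<le> (1 + K) * norm x" for n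
      using norm_triangle_ineq4[of x "(T ^^ n) x"] K(2)[of n x] by (simp add: algebra_simps)
    then show "\<forall>\<^sub>F n in sequentially. norm (A n (x - T x)) \<le> (1 / real n) * ((1 + K) * norm x)"
      unfolding cesaro_mean_coboundary[OF T.linear_axioms] norm_scaleR
      by (intro always_eventually allI mult_mono) auto
    show "(\<lambda>n. (1 / real n) * ((1 + K) * norm x)) \<longlonglongrightarrow> 0"
      by (intro tendsto_mult_left_zero lim_1_over_n)
  qed
  then have "P (x - T x) = 0"
    using LIMSEQ_unique[OF tendsto_P] by blast
  then show ?thesis by (simp add: P.diff)
qed

lemma T_P: "T (P x) = P x"
proof -
  have "T (A n x) = A n (T x)" for n
    by (simp add: cesaro_mean_def T.scaleR T.sum funpow_swap1)
  moreover have "(\<lambda>n. T (A n x)) \<longlonglongrightarrow> T (P x)"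
    by (intro T.tendsto tendsto_P)
  ultimately have "(\<lambda>n. A n (T x)) \<longlonglongrightarrow> T (P x)"
    by simp
  then show ?thesis
    using LIMSEQ_unique[OF tendsto_P] P_T by metis
qed

lemma P_fixed:
  assumes "T x = x"
  shows "P x = x"
proof (rule LIMSEQ_unique[OF tendsto_P])
  show "(\<lambda>n. A n x) \<longlonglongrightarrow> x"
    by (rule tendsto_eventually)
      (auto simp: eventually_sequentially cesaro_mean_fixed[of T, OF assms] intro!: exI[of _ 1])
qed

end

locale irreducible_mean_ergodic_operator = mean_ergodic_operator +
  assumes irreducible: "irreducible_operator T"
    and P_nonzero: "mean_ergodic_projection T \<noteq> (\<lambda>x. 0)"
begin

section \<open>Strict positivity and the one-dimensional fixed space\<close>

lemma invariant_ideal_eq_UNIV: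
  assumes "x \<in> J" "x \<noteq> 0" "lattice_ideal J" "closed J" "T ` J \<subseteq> J"
  shows "z \<in> J"
  using irreducible assms unfolding irreducible_operator_def by blast

lemma P_strict:
  assumes "P \<bar>z\<bar> = 0"
  shows "z = 0"
proof (rule ccontr)
  assume "z \<noteq> 0"
  let ?J = "{z. P \<bar>z\<bar> = 0}"
  have le_zero: "P \<bar>a\<bar> = 0" if "\<bar>a\<bar> \<le> b" "P b = 0" for a b
    using P_mono[OF that(1)] P_nonneg[of "\<bar>a\<bar>"] that(2) by (intro order_antisym) auto
  have "lattice_ideal ?J"
    unfolding lattice_ideal_def
  proof (intro conjI ballI allI impI)
    show "subspace ?J"
    proof (rule subspaceI)
      show "a + b \<in> ?J" if "a \<in> ?J" "b \<in> ?J" for a b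
        using that le_zero[OF abs_triangle_ineq, of a b] by (simp add: P.add)
      show "c *\<^sub>R a \<in> ?J" if "a \<in> ?J" for c a
        using that le_zero[OF abs_scaleR_le, of c a] by (simp add: P.scaleR)
    qed (simp add: P.zero)
    show "b \<in> ?J" if "a \<in> ?J" "\<bar>b\<bar> \<le> \<bar>a\<bar>" for a b
      using that le_zero by auto
  qed
  moreover have "closed ?J"
    unfolding closed_sequential_limits
  proof (intro allI impI, elim conjE)
    fix x l assume x: "\<forall>n. x n \<in> ?J" "x \<longlonglongrightarrow> l"
    then have "(\<lambda>n. P \<bar>x n\<bar>) \<longlonglongrightarrow> P \<bar>l\<bar>"
      by (intro P.tendsto tendsto_abs_lattice)
    with x(1) show "l \<in> ?J" by (simp add: LIMSEQ_const_iff)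
  qed
  \<comment> \<open>\<open>|T z| \<le> T |z|\<close>, and
    \<open>P (T |z|) = P |z| = 0\<close>.\<close>
  moreover have "T ` ?J \<subseteq> ?J"
    using le_zero[OF positive_operatorD(4)[OF T]] by (auto simp: P_T)
  ultimately have "P \<bar>x\<bar> = 0" for x
    using invariant_ideal_eq_UNIV[of z ?J] assms \<open>z \<noteq> 0\<close> by blast
  then have "P x = 0" for x
    using positive_operatorD(4)[OF P_positive, of x] by simp
  with P_nonzero show False by blast
qed

text \<open>
  The set \<open>J\<close> below is the closed ideal generated by \<open>y\<close>, described without reference to the
  closure of the principal ideal.
\<close>

lemma fixed_point_quasi_interior:
  assumes y: "0 \<le> y" "y \<noteq> 0" "T y = y" and e: "e > 0"
  shows "\<exists>c>0. norm (pprt (\<bar>x\<bar> - c *\<^sub>R y)) < e"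
proof -
  define J where "J = {x. \<forall>e>0. \<exists>c>0. norm (pprt (\<bar>x\<bar> - c *\<^sub>R y)) < e}"
  have JD: "\<exists>c>0. norm (pprt (\<bar>a\<bar> - c *\<^sub>R y)) < e" if "a \<in> J" "e > 0" for a e
    using that by (simp add: J_def)
  have ideal: "lattice_ideal J"
    unfolding lattice_ideal_def
  proof (intro conjI ballI allI impI)
    show "subspace J"
    proof (rule subspaceI)
      show "0 \<in> J"
        unfolding J_def using y(1) by (intro CollectI allI impI exI[of _ 1]) simp
      show "a + b \<in> J" if ab: "a \<in> J" "b \<in> J" for a b
        unfolding J_def
      proof (intro CollectI allI impI)
        fix e :: real assume "e > 0"
        then have "e / 2 > 0" by simp
        then obtain c d where cd: "c > 0" "norm (pprt (\<bar>a\<bar> - c *\<^sub>R y)) < e / 2"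
            "d > 0" "norm (pprt (\<bar>b\<bar> - d *\<^sub>R y)) < e / 2"
          using JD[OF ab(1)] JD[OF ab(2)] by blast
        have "\<bar>a + b\<bar> - (c + d) *\<^sub>R y \<le> (\<bar>a\<bar> - c *\<^sub>R y) + (\<bar>b\<bar> - d *\<^sub>R y)"
          using abs_triangle_ineq[of a b] by (simp add: algebra_simps)
        then have "norm (pprt (\<bar>a + b\<bar> - (c + d) *\<^sub>R y)) \<le>
            norm (pprt (\<bar>a\<bar> - c *\<^sub>R y)) + norm (pprt (\<bar>b\<bar> - d *\<^sub>R y))"
          by (rule order_trans[OF norm_pprt_mono norm_pprt_add_le])
        with cd have "norm (pprt (\<bar>a + b\<bar> - (c + d) *\<^sub>R y)) < e" by simp
        then show "\<exists>c>0. norm (pprt (\<bar>a + b\<bar> - c *\<^sub>R y)) < e"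
          using cd by (intro exI[of _ "c + d"]) simp
      qed
      show "s *\<^sub>R a \<in> J" if a: "a \<in> J" for s a
        unfolding J_def
      proof (intro CollectI allI impI)
        fix e :: real assume "e > 0"
        define k where "k = \<bar>s\<bar> + 1"
        have k: "k > 0" "\<bar>s\<bar> \<le> k" by (simp_all add: k_def)
        have "e / k > 0" using \<open>e > 0\<close> k by simp
        then obtain c where c: "c > 0" "norm (pprt (\<bar>a\<bar> - c *\<^sub>R y)) < e / k"
          using JD[OF a] by blast
        have "\<bar>s *\<^sub>R a\<bar> \<le> k *\<^sub>R \<bar>a\<bar>"
          by (rule order_trans[OF abs_scaleR_le scaleR_right_mono[OF k(2) abs_ge_zero]])
        then have "pprt (\<bar>s *\<^sub>R a\<bar> - (k * c) *\<^sub>R y) \<le> pprt (k *\<^sub>R (\<bar>a\<bar> - c *\<^sub>R y))"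
          by (intro pprt_mono) (simp add: algebra_simps)
        also have "\<dots> \<le> k *\<^sub>R pprt (\<bar>a\<bar> - c *\<^sub>R y)"
          using k by (intro pprt_scaleR_le) simp
        finally have "norm (pprt (\<bar>s *\<^sub>R a\<bar> - (k * c) *\<^sub>R y)) \<le> k * norm (pprt (\<bar>a\<bar> - c *\<^sub>R y))"
          using norm_mono_nonneg[OF zero_le_pprt, of _ "k *\<^sub>R pprt (\<bar>a\<bar> - c *\<^sub>R y)"] k by simp
        also have "\<dots> < e" using c k by (simp add: field_simps)
        finally show "\<exists>c>0. norm (pprt (\<bar>s *\<^sub>R a\<bar> - c *\<^sub>R y)) < e"
          using c k by (intro exI[of _ "k * c"]) simp
      qed
    qed
    show "b \<in> J" if "a \<in> J" "\<bar>b\<bar> \<le> \<bar>a\<bar>" for a b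
    proof -
      have "norm (pprt (\<bar>b\<bar> - c *\<^sub>R y)) \<le> norm (pprt (\<bar>a\<bar> - c *\<^sub>R y))" for c
        using that(2) by (intro norm_pprt_mono diff_right_mono)
      then show ?thesis
        using that(1) unfolding J_def by (blast intro: le_less_trans)
    qed
  qed
  have "closed J"
    unfolding closed_sequential_limits
  proof (intro allI impI, elim conjE)
    fix z l assume z: "\<forall>n. z n \<in> J" "z \<longlonglongrightarrow> l"
    show "l \<in> J"
      unfolding J_def
    proof (intro CollectI allI impI)
      fix e :: real assume "e > 0"
      then obtain n where n: "norm (z n - l) < e / 2"
        using LIMSEQ_D[OF z(2), of "e / 2"] by auto
      obtain c where c: "c > 0" "norm (pprt (\<bar>z n\<bar> - c *\<^sub>R y)) < e / 2"
        using JD[of "z n" "e / 2"] z(1) \<open>e > 0\<close> by auto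
      have "\<bar>l\<bar> - c *\<^sub>R y \<le> (\<bar>z n\<bar> - c *\<^sub>R y) + \<bar>z n - l\<bar>"
        using abs_triangle_ineq2[of l "z n"] by (simp add: abs_minus_commute algebra_simps)
      then have "norm (pprt (\<bar>l\<bar> - c *\<^sub>R y)) \<le>
          norm (pprt (\<bar>z n\<bar> - c *\<^sub>R y)) + norm (pprt \<bar>z n - l\<bar>)"
        by (rule order_trans[OF norm_pprt_mono norm_pprt_add_le])
      also have "\<dots> < e"
        using n c(2) by (simp add: norm_abs)
      finally show "\<exists>c>0. norm (pprt (\<bar>l\<bar> - c *\<^sub>R y)) < e" using c(1) by blast
    qed
  qed
  moreover have "T ` J \<subseteq> J"
  proof (intro image_subsetI)
    fix a assume a: "a \<in> J"
    obtain K where K: "K > 0" "\<And>z. norm (T z) \<le> norm z * K"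
      using T.pos_bounded by auto
    show "T a \<in> J"
      unfolding J_def
    proof (intro CollectI allI impI)
      fix e :: real assume "e > 0"
      then have "e / K > 0" using K by simp
      then obtain c where c: "c > 0" "norm (pprt (\<bar>a\<bar> - c *\<^sub>R y)) < e / K"
        using JD[OF a] by blast
      \<comment> \<open>Since \<open>T y = y\<close>, the excess of \<open>|T a|\<close> over
        \<open>c *\<^sub>R y\<close> is dominated by the image under \<open>T\<close> of the excess
        of \<open>|a|\<close>.\<close>
      have "\<bar>T a\<bar> - c *\<^sub>R y \<le> T (\<bar>a\<bar> - c *\<^sub>R y)"
        using positive_operatorD(4)[OF T, of a] by (simp add: T.diff T.scaleR y(3))
      also have "\<dots> \<le> T (pprt (\<bar>a\<bar> - c *\<^sub>R y))"
        by (intro positive_operatorD(3)[OF T] self_le_pprt)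
      finally have "pprt (\<bar>T a\<bar> - c *\<^sub>R y) \<le> T (pprt (\<bar>a\<bar> - c *\<^sub>R y))"
        using positive_operatorD(2)[OF T zero_le_pprt] by (simp add: pprt_def)
      then have "norm (pprt (\<bar>T a\<bar> - c *\<^sub>R y)) \<le> norm (T (pprt (\<bar>a\<bar> - c *\<^sub>R y)))"
        by (intro norm_mono_nonneg) simp_all
      also have "\<dots> < e"
        using K(2)[of "pprt (\<bar>a\<bar> - c *\<^sub>R y)"] c(2) K(1) by (simp add: field_simps)
      finally show "\<exists>c>0. norm (pprt (\<bar>T a\<bar> - c *\<^sub>R y)) < e" using c(1) by blast
    qed
  qed
  moreover have "y \<in> J"
    unfolding J_def using y(1) by (intro CollectI allI impI exI[of _ 1]) (simp add: abs_of_nonneg)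
  ultimately have "x \<in> J"
    using ideal y(2) invariant_ideal_eq_UNIV[of y J x] by simp
  with e show ?thesis by (simp add: J_def)
qed

text \<open>The positive part \<open>p\<close> of a fixed point is fixed too, since
  \<open>p \<le> P p\<close> and \<open>P\<close> annihilates the nonnegative difference. If
  nonzero, \<open>p\<close> is quasi-interior, so \<open>pprt (- z)\<close>, being disjoint from it,
  vanishes.\<close>

lemma fixed_point_comparable:
  assumes z: "T z = z"
  shows "0 \<le> z \<or> z \<le> 0"
proof (rule disjCI)
  assume nz: "\<not> z \<le> 0"
  let ?p = "pprt z" and ?q = "pprt (- z)"
  \<comment> \<open>\<open>P ?p\<close> dominates both \<open>P z = z\<close> and 0.\<close>
  have "?p \<le> P ?p"
    using P_mono[OF self_le_pprt[of z]] P_nonneg[OF zero_le_pprt[of z]] P_fixed[OF z]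
    by (simp add: pprt_def)
  then have "P \<bar>P ?p - ?p\<bar> = P (P ?p - ?p)" by (simp add: abs_of_nonneg)
  also have "\<dots> = 0" by (simp add: P.diff P_fixed[OF T_P])
  finally have "P ?p = ?p" using P_strict[of "P ?p - ?p"] by simp
  then have T_p: "T ?p = ?p" using T_P by metis
  have p: "?p \<noteq> 0" using nz by (simp add: le_zero_iff_zero_pprt)
  have "- z \<le> 0"
  proof (rule le_zero_of_norm_pprt)
    fix e :: real assume "e > 0"
    from fixed_point_quasi_interior[OF zero_le_pprt p T_p this, of ?q]
    obtain c where c: "c > 0" "norm (pprt (?q - c *\<^sub>R ?p)) < e" by (auto simp: abs_of_nonneg)
    \<comment> \<open>\<open>c\<close> may be below 1, while the disjointness criterion asks for a
      factor of at least 1.\<close>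
    have "c *\<^sub>R ?p \<le> max 1 c *\<^sub>R ?p" by (intro scaleR_right_mono) auto
    then have "inf ?q (c *\<^sub>R ?p) \<le> 0"
      by (intro le_zero_of_le_scaled_pprts[of _ z "max 1 c"]) (auto intro: le_infI2)
    \<comment> \<open>By disjointness \<open>?q\<close> lies entirely in its excess over
      \<open>c *\<^sub>R ?p\<close>, whose norm is below \<open>e\<close>.\<close>
    then have "?q \<le> ?q - inf ?q (c *\<^sub>R ?p)" by (metis diff_left_mono diff_zero)
    also have "\<dots> = pprt (?q - c *\<^sub>R ?p)"
      by (rule diff_inf_eq_pprt)
    finally show "norm ?q < e"
      using c(2) norm_mono_nonneg[OF zero_le_pprt] by (meson le_less_trans)
  qed
  then show "0 \<le> z" by simp
qed

text \<open>\<open>z\<close> is comparable with every multiple of \<open>y\<close>, so the closed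
  sets of scalars \<open>a\<close> with \<open>a y\<close> below, respectively above,
  \<open>z\<close> cover the real line. Both are nonempty, and connectedness yields a common
  scalar.\<close>

lemma fixed_point_multiple:
  assumes y: "0 \<le> y" "y \<noteq> 0" "T y = y" and z: "T z = z"
  shows "\<exists>a. z = a *\<^sub>R y"
proof -
  have comp: "w \<le> a *\<^sub>R y \<or> a *\<^sub>R y \<le> w" if "T w = w" for w a
    using fixed_point_comparable[of "w - a *\<^sub>R y"] that by (auto simp: T.diff T.scaleR y(3))
  have above: "\<exists>a. w \<le> a *\<^sub>R y" if "T w = w" for w
  proof (rule ccontr)
    assume "\<not> ?thesis"
    \<comment> \<open>By comparability every \<open>real n *\<^sub>R y\<close> would lie below
      \<open>w\<close>.\<close>
    then have "y \<le> 0" using comp[OF that] by (intro archimedean_le_zero[of y w]) blast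
    with y show False by simp
  qed
  let ?L = "{a. a *\<^sub>R y \<le> z}" and ?U = "{a. z \<le> a *\<^sub>R y}"
  have scale: "(\<lambda>n. s n *\<^sub>R y) \<longlonglongrightarrow> t *\<^sub>R y" if "s \<longlonglongrightarrow> t" for s :: "nat \<Rightarrow> real" and t
    using that by (intro tendsto_intros)
  have "closed ?L" "closed ?U"
    unfolding closed_sequential_limits
    using tendsto_le_lattice[OF scale tendsto_const, of _ _ 0 z]
      tendsto_le_lattice[OF tendsto_const scale, of _ _ 0 z] by auto
  moreover have "?U \<noteq> {}" using above[OF z] by blast
  moreover have "?L \<noteq> {}"
  proof -
    obtain a where "- z \<le> a *\<^sub>R y" using above[of "- z"] z by (auto simp: T.neg)
    then have "(- a) *\<^sub>R y \<le> z" by (simp add: minus_le_iff)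
    then show ?thesis by blast
  qed
  moreover have "UNIV \<subseteq> ?L \<union> ?U" using comp[OF z] by blast
  ultimately have "?L \<inter> ?U \<noteq> {}"
    using connected_UNIV[where 'a = real] unfolding connected_closed by (metis inf_top_right)
  then show ?thesis by (auto intro: antisym)
qed

text \<open>The projection has rank one, which yields the invariant functional without Hahn-Banach.\<close>

lemma ergodic_pair_exists:
  obtains \<phi> y where "ergodic_pair T \<phi> y" "\<And>x. P x = \<phi> x *\<^sub>R y"
proof -
  obtain x0 where x0: "P x0 \<noteq> 0" using P_nonzero by blast
  define y where "y = P \<bar>x0\<bar>"
  \<comment> \<open>If \<open>y\<close> vanished, strict positivity would give
    \<open>x0 = 0\<close>, contradicting \<open>P x0 \<noteq> 0\<close>.\<close>
  have y: "0 \<le> y" "T y = y" "y \<noteq> 0"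
    using x0 P_strict[of x0] by (auto simp: y_def P_nonneg T_P P.zero)
  obtain \<phi> where \<phi>: "\<And>x. P x = \<phi> x *\<^sub>R y"
    using fixed_point_multiple[OF y(1,3,2) T_P] by metis
  \<comment> \<open>Cancelling \<open>y\<close> lets \<open>\<phi>\<close> inherit its identities
    from \<open>P\<close>.\<close>
  have unique: "a = b" if "a *\<^sub>R y = b *\<^sub>R y" for a b
    using that y(3) by simp
  obtain K where K: "\<And>x. norm (P x) \<le> norm x * K" using P.bounded by blast
  have "ergodic_pair T \<phi> y"
  proof (intro ergodic_pair.intro invariant_pair.intro ergodic_pair_axioms.intro)
    show "positive_operator T" "0 \<le> y" "T y = y" by (rule T y)+
    show "bounded_linear \<phi>"
    proof (rule bounded_linear_intro)
      show "\<phi> (a + b) = \<phi> a + \<phi> b" for a b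
        by (rule unique) (simp add: scaleR_add_left P.add flip: \<phi>)
      show "\<phi> (c *\<^sub>R a) = c *\<^sub>R \<phi> a" for c a
        by (rule unique) (simp add: P.scaleR flip: \<phi> scaleR_scaleR)
      show "norm (\<phi> x) \<le> norm x * (K / norm y)" for x
        using K[of x] y(3) by (simp add: \<phi> field_simps)
    qed
    show "0 \<le> \<phi> x" if "0 \<le> x" for x
    proof (rule ccontr)
      assume "\<not> 0 \<le> \<phi> x"
      \<comment> \<open>A negative value \<open>\<phi> x\<close> would exhibit \<open>- y\<close> as
        a nonnegative multiple of \<open>P x\<close>.\<close>
      then have "(- inverse (\<phi> x)) *\<^sub>R P x = - y" "0 \<le> - inverse (\<phi> x)" by (simp_all add: \<phi>)
      then have "0 \<le> - y" using P_nonneg[OF that] scaleR_nonneg_nonneg by metis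
      with y show False by simp
    qed
    show "\<phi> (T x) = \<phi> x" for x
      by (rule unique) (simp add: P_T flip: \<phi>)
    show "\<phi> y = 1"
      by (rule unique) (simp add: P_fixed y flip: \<phi>)
    show "x = 0" if "0 \<le> x" "\<phi> x = 0" for x
      by (rule P_strict) (use that in \<open>simp add: \<phi> abs_of_nonneg\<close>)
    show "\<exists>c>0. norm (pprt (\<bar>x\<bar> - c *\<^sub>R y)) < e" if "e > 0" for e x
      by (rule fixed_point_quasi_interior[OF y(1,3,2) that])
    show "(\<lambda>n. A n x) \<longlonglongrightarrow> \<phi> x *\<^sub>R y" for x
      using tendsto_P by (simp flip: \<phi>)
  qed
  then show thesis using \<phi> by (rule that)
qed

end

theorem corollary4p14:
  fixes T :: "'a::banach_lattice \<Rightarrow> 'a"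
  assumes "order_continuous_norm TYPE('a)"
    and "\<exists>u::'a. weak_unit u"
    and "positive_operator T"
    and "power_bounded T"
    and "irreducible_operator T"
    and "mean_ergodic T"
    and "mean_ergodic_projection T \<noteq> (\<lambda>x. 0)"
  shows "\<forall>x. uo_convergent_to (\<lambda>n. cesaro_mean T (Suc n) x) (mean_ergodic_projection T x)"
proof -
  interpret irreducible_mean_ergodic_operator T
    using assms by unfold_locales
  obtain \<phi> y where "ergodic_pair T \<phi> y" and P: "\<And>x. P x = \<phi> x *\<^sub>R y"
    using ergodic_pair_exists by blast
  then interpret ergodic_pair T \<phi> y by blast
  show ?thesis
    using uo_convergent_cesaro_mean[OF assms(1)] by (simp add: P)
qed

end
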